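(* For a topological space $X$, the following conditions are equivalent: (1) $X$ is a GCC space; (2) every disjoint open cover of $X$ (i.e. every cover of $X$ by pairwise disjoint open subsets) has a finite subcover; (3) every countable clopen cover of $X$ has a finite subcover; (4) every decreasing sequence $F_1\supseteq F_2\supseteq\cdots$ of non-empty clopen subsets of $X$ has a non-empty intersection; (5) there is no continuous function from $X$ onto $\mathbb{N}$ (with $\mathbb N$ carrying the discrete topology); (6) $X$ is not a direct sum of infinitely many of its non-empty subspaces.
   Context: A topological space $X$ is a GCC space if it cannot be represented as a union of infinitely many of its pairwise disjoint non-empty open subsets. No separation axioms are assumed. A clopen cover is a cover by subsets that are both open and closed. $X$ is a direct sum of a family $(X_i)_{i\in I}$ of its subspaces if the $X_i$ are pairwise disjoint, their union is $X$, and the topology of $X$ is the disjoint-union (topological sum) topology of the $X_i$. *)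

theory Defs
  imports "HOL-Analysis.Analysis"
begin

definition GCC_space :: "'a topology \<Rightarrow> bool" where
  "GCC_space X \<longleftrightarrow>
    \<not> (\<exists>\<U>. infinite \<U> \<and> (\<forall>U\<in>\<U>. openin X U \<and> U \<noteq> {}) \<and> disjoint \<U> \<and> \<Union>\<U> = topspace X)"

definition clopenin :: "'a topology \<Rightarrow> 'a set \<Rightarrow> bool" where
  "clopenin X U \<longleftrightarrow> closedin X U \<and> openin X U"

definition has_finite_subcover :: "'a topology \<Rightarrow> 'a set set \<Rightarrow> bool" where
  "has_finite_subcover X \<U> \<longleftrightarrow> (\<exists>\<V>\<subseteq>\<U>. finite \<V> \<and> \<Union>\<V> = topspace X)"

(* The underlying set of sum_topology consists of pairs (i, x) with x in S i; the last clause says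
   that the canonical map (i, x) |-> x identifies the topological sum of the subspaces with X. *)
definition direct_sum_of_subspaces :: "'a topology \<Rightarrow> 'i set \<Rightarrow> ('i \<Rightarrow> 'a set) \<Rightarrow> bool" where
  "direct_sum_of_subspaces X I S \<longleftrightarrow>
    disjoint_family_on S I \<and> (\<Union>i\<in>I. S i) = topspace X \<and>
    homeomorphic_map (sum_topology (\<lambda>i. subtopology X (S i)) I) X snd"

end

theory Submission
  imports Defs
begin

text \<open>
  The conditions are cyclically related through their negations. An infinite partition into open
  sets makes a continuous surjection onto the natural numbers: send the partition onto
  \<^term>\<open>UNIV :: nat set\<close> and each point to the image of its piece
  (\<open>not_GCC_imp_surjection_onto_nat\<close>). The tails of such a surjection are clopen, non-empty and
  decreasing with empty intersection; their complements are a countable clopen cover without finite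
  subcover. Enumerating such a cover and subtracting from every member the earlier ones
  yields a disjoint open cover, infinitely many of whose members are non-empty,
  since otherwise finitely many of the original sets would cover
  (\<open>countable_clopen_cover_imp_not_GCC\<close>).

  Disjoint open covers fit in because a finite subcover of a disjoint cover must already contain
  all of its non-empty members. Direct sums fit in because a
  partition decomposes the topology as a sum exactly when its pieces are open
  (\<open>direct_sum_of_subspaces_iff_open\<close>).
\<close>

section \<open>Partitions, surjections onto the natural numbers and clopen sets\<close>

lemma not_GCC_imp_surjection_onto_nat:
  assumes "\<not> GCC_space X"
  shows "\<exists>f. continuous_map X (discrete_topology (UNIV :: nat set)) f \<and> f ` topspace X = UNIV"
proof -
  obtain \<U> where inf: "infinite \<U>" and opn: "\<And>U. U \<in> \<U> \<Longrightarrow> openin X U"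
    and ne: "\<And>U. U \<in> \<U> \<Longrightarrow> U \<noteq> {}" and dis: "disjoint \<U>" and cov: "\<Union>\<U> = topspace X"
    using assms unfolding GCC_space_def by blast
  obtain e :: "nat \<Rightarrow> 'a set" where e: "inj e" "range e \<subseteq> \<U>"
    using inf infinite_countable_subset by blast
  define piece where "piece x = (THE U. U \<in> \<U> \<and> x \<in> U)" for x
  have piece: "piece x = U" if "U \<in> \<U>" "x \<in> U" for x U
    unfolding piece_def using that dis by (intro the_equality) (auto simp: disjoint_def)
  \<comment> \<open>Outside the range of \<open>e\<close> the inverse has some unspecified value; only
      \<open>inv e (e n) = n\<close> matters, because any union of pieces is open.\<close>
  define f where "f x = inv e (piece x)" for x
  have "openin X {x \<in> topspace X. f x \<in> N}" for N
  proof -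
    have "{x \<in> topspace X. f x \<in> N} = \<Union>{U \<in> \<U>. inv e U \<in> N}"
    proof (intro subset_antisym subsetI)
      fix x assume "x \<in> {x \<in> topspace X. f x \<in> N}"
      then obtain U where "U \<in> \<U>" "x \<in> U" "f x \<in> N"
        using cov by blast
      then show "x \<in> \<Union>{U \<in> \<U>. inv e U \<in> N}"
        using piece by (auto simp: f_def)
    qed (use piece cov in \<open>auto simp: f_def\<close>)
    then show ?thesis
      using opn by auto
  qed
  then have "continuous_map X (discrete_topology UNIV) f"
    by (simp add: continuous_map_def)
  moreover have "n \<in> f ` topspace X" for n
  proof -
    have "e n \<in> \<U>" using e by auto
    then obtain x where "x \<in> e n" using ne by blast
    then have "x \<in> topspace X" "f x = n"
      using piece[OF \<open>e n \<in> \<U>\<close>] \<open>e n \<in> \<U>\<close> cov e by (auto simp: f_def)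
    then show ?thesis by auto
  qed
  ultimately show ?thesis by auto
qed

lemma surjection_onto_nat_imp_clopen_decseq:
  assumes f: "continuous_map X (discrete_topology (UNIV :: nat set)) f" "f ` topspace X = UNIV"
  shows "\<exists>F :: nat \<Rightarrow> 'a set. decseq F \<and> (\<forall>n. clopenin X (F n) \<and> F n \<noteq> {}) \<and> (\<Inter>n. F n) = {}"
proof (intro exI conjI allI)
  let ?F = "\<lambda>n. {x \<in> topspace X. f x \<in> {n..}}"
  show "decseq ?F"
    by (auto simp: decseq_def)
  show "clopenin X (?F n)" for n
    unfolding clopenin_def
    using openin_continuous_map_preimage[OF f(1), of "{n..}"]
      closedin_continuous_map_preimage[OF f(1), of "{n..}"] by simp
  show "?F n \<noteq> {}" for n
  proof -
    have "n \<in> f ` topspace X" using f by simp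
    then show ?thesis by auto
  qed
  have "x \<notin> ?F (Suc (f x))" for x
    by simp
  then show "(\<Inter>n. ?F n) = {}"
    by blast
qed

text \<open>Complements turn a decreasing sequence with empty intersection into an increasing cover, of
  which a finite part is contained in a single member.\<close>

lemma clopen_decseq_imp_countable_clopen_cover:
  assumes F: "decseq (F :: nat \<Rightarrow> 'a set)" "\<And>n. clopenin X (F n)" "\<And>n. F n \<noteq> {}"
    and empty: "(\<Inter>n. F n) = {}"
  shows "\<exists>\<U>. countable \<U> \<and> (\<forall>U\<in>\<U>. clopenin X U) \<and> \<Union>\<U> = topspace X \<and> \<not> has_finite_subcover X \<U>"
proof (intro exI conjI ballI)
  let ?\<U> = "range (\<lambda>n. topspace X - F n)"
  show "countable ?\<U>" by simp
  show "clopenin X U" if "U \<in> ?\<U>" for U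
    using that F(2) by (auto simp: clopenin_def)
  show "\<Union>?\<U> = topspace X"
    using empty by auto
  show "\<not> has_finite_subcover X ?\<U>"
  proof
    assume "has_finite_subcover X ?\<U>"
    then obtain K where K: "finite K" "(\<Union>n\<in>K. topspace X - F n) = topspace X"
      unfolding has_finite_subcover_def by (metis finite_subset_image)
    obtain m where m: "\<And>n. n \<in> K \<Longrightarrow> n \<le> m"
      using K(1) finite_nat_set_iff_bounded_le by auto
    obtain x where x: "x \<in> F m" using F(3) by blast
    then have "x \<in> topspace X"
      using F(2) by (meson clopenin_def openin_subset subsetD)
    moreover have "x \<in> F n" if "n \<in> K" for n
      using decseqD[OF F(1) m[OF that]] x by blast
    ultimately show False
      using K(2) by auto
  qed
qed

text \<open>This is where clopenness is essential: only because the members are closed as well does the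
  subtraction of finitely many earlier members leave an open set. Countability lets the members be
  enumerated with only finitely many predecessors each.\<close>

lemma countable_clopen_cover_imp_not_GCC:
  assumes "countable \<U>" and clop: "\<And>U. U \<in> \<U> \<Longrightarrow> clopenin X U" and cov: "\<Union>\<U> = topspace X"
    and nofin: "\<not> has_finite_subcover X \<U>"
  shows "\<not> GCC_space X"
proof -
  have "\<U> \<noteq> {}"
    using cov nofin by (auto simp: has_finite_subcover_def)
  then obtain A :: "nat \<Rightarrow> 'a set" where A: "\<U> = range A"
    using \<open>countable \<U>\<close> by (metis uncountable_def)
  let ?D = "disjointed A"
  have "openin X (?D n)" for n
    unfolding disjointed_def using clop A
    by (intro openin_diff closedin_Union) (auto simp: clopenin_def)
  moreover have "disjoint (range ?D - {{}})"
    by (rule pairwise_subset[OF disjoint_family_on_disjoint_image[OF disjoint_family_disjointed]])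
      blast
  moreover have "\<Union>(range ?D - {{}}) = topspace X"
  proof -
    have "\<Union>(range ?D - {{}}) = \<Union>(range ?D)"
      by blast
    then show ?thesis
      using UN_disjointed_eq[of A] cov A by simp
  qed
  moreover have "infinite (range ?D - {{}})"
  proof
    \<comment> \<open>Finitely many distinct differences already arise from finitely many indices, and
        the original sets at these indices would cover.\<close>
    assume "finite (range ?D - {{}})"
    then have "finite (range ?D)"
      by simp
    then obtain K where K: "finite K" "range ?D = ?D ` K"
      by (metis finite_subset_image subset_refl subset_UNIV subset_antisym image_mono)
    have "topspace X = (\<Union>n\<in>K. ?D n)"
      using UN_disjointed_eq[of A] cov A K(2) by simp
    also have "\<dots> \<subseteq> \<Union>(A ` K)"
      using disjointed_subset by fast
    finally have "\<Union>(A ` K) = topspace X"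
      using cov A by blast
    moreover have "A ` K \<subseteq> \<U>" "finite (A ` K)"
      using A K(1) by auto
    ultimately show False
      using nofin unfolding has_finite_subcover_def by blast
  qed
  ultimately show ?thesis
    unfolding GCC_space_def not_not
    by (intro exI[of _ "range ?D - {{}}"]) auto
qed

section \<open>Disjoint open covers\<close>

text \<open>The empty set may be a member of a disjoint cover, whence its removal below; every other
  member is indispensable, as its points lie in no further member.\<close>

lemma GCC_space_iff_disjoint_open_covers:
  "GCC_space X \<longleftrightarrow>
    (\<forall>\<U>. (\<forall>U\<in>\<U>. openin X U) \<and> disjoint \<U> \<and> \<Union>\<U> = topspace X \<longrightarrow> has_finite_subcover X \<U>)"
  (is "_ \<longleftrightarrow> ?fin")
proof
  assume gcc: "GCC_space X"
  show ?fin
  proof (intro allI impI)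
    fix \<U> assume \<U>: "(\<forall>U\<in>\<U>. openin X U) \<and> disjoint \<U> \<and> \<Union>\<U> = topspace X"
    then have "finite (\<U> - {{}})"
      using gcc unfolding GCC_space_def
      by (auto simp: disjoint_def dest!: spec[of _ "\<U> - {{}}"])
    then have "finite \<U>" by simp
    then show "has_finite_subcover X \<U>"
      using \<U> unfolding has_finite_subcover_def by blast
  qed
next
  assume fin: ?fin
  show "GCC_space X"
    unfolding GCC_space_def
  proof
    assume "\<exists>\<U>. infinite \<U> \<and> (\<forall>U\<in>\<U>. openin X U \<and> U \<noteq> {}) \<and> disjoint \<U> \<and> \<Union>\<U> = topspace X"
    then obtain \<U> where \<U>: "infinite \<U>" "\<forall>U\<in>\<U>. openin X U \<and> U \<noteq> {}" "disjoint \<U>" "\<Union>\<U> = topspace X"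
      by blast
    then have "has_finite_subcover X \<U>"
      using fin by simp
    then obtain \<V> where \<V>: "\<V> \<subseteq> \<U>" "finite \<V>" "\<Union>\<V> = topspace X"
      unfolding has_finite_subcover_def by blast
    then obtain U where U: "U \<in> \<U>" "U \<notin> \<V>"
      using \<U>(1) by (metis finite_subset subsetI)
    then obtain x where "x \<in> U" using \<U>(2) by blast
    moreover from this obtain V where "V \<in> \<V>" "x \<in> V"
      using U(1) \<U>(4) \<V>(3) by blast
    moreover from this have "U \<inter> V = {}"
      using U \<V>(1) \<U>(3) by (metis disjointD subsetD)
    ultimately show False
      by blast
  qed
qed

section \<open>Direct sums of subspaces\<close>

text \<open>A summand is always open in a topological sum, and a homeomorphism keeps it open in
  \<open>X\<close>. Conversely, for a disjoint cover the projection is always a continuous bijection, and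
  openness of the pieces makes it an open map, since relatively open subsets of
  open sets are open.\<close>

lemma direct_sum_of_subspaces_iff_open:
  "direct_sum_of_subspaces X I S \<longleftrightarrow>
    disjoint_family_on S I \<and> (\<Union>i\<in>I. S i) = topspace X \<and> (\<forall>i\<in>I. openin X (S i))"
proof -
  let ?T = "sum_topology (\<lambda>i. subtopology X (S i)) I"
  have "homeomorphic_map ?T X snd \<longleftrightarrow> (\<forall>i\<in>I. openin X (S i))"
    if dis: "disjoint_family_on S I" and cov: "(\<Union>i\<in>I. S i) = topspace X"
  proof
    have sub: "S i \<subseteq> topspace X" if "i \<in> I" for i
      using cov that by blast
    have top: "topspace ?T = Sigma I S"
      using sub by fastforce
    {
      assume hom: "homeomorphic_map ?T X snd"
      show "\<forall>i\<in>I. openin X (S i)"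
      proof
        fix i assume i: "i \<in> I"
        have "openin (subtopology X (S i)) (S i)"
          using openin_topspace[of "subtopology X (S i)"] sub[OF i] by (simp add: inf_absorb2)
        then have "openin ?T (Pair i ` S i)"
          using open_map_component_injection[OF i, of "\<lambda>i. subtopology X (S i)"]
          by (simp add: open_map_def)
        then have "openin X (snd ` Pair i ` S i)"
          using homeomorphic_imp_open_map[OF hom] by (simp add: open_map_def)
        then show "openin X (S i)"
          by (simp add: image_image)
      qed
    next
      assume opn: "\<forall>i\<in>I. openin X (S i)"
      show "homeomorphic_map ?T X snd"
      proof (rule bijective_open_imp_homeomorphic_map)
        show "continuous_map ?T X snd"
          unfolding continuous_map_def
        proof (intro conjI allI impI)
          show "snd \<in> topspace ?T \<rightarrow> topspace X"
            unfolding top using cov by auto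
          fix U assume U: "openin X U"
          have "{x \<in> topspace ?T. snd x \<in> U} = Sigma I (\<lambda>i. U \<inter> S i)"
            unfolding top by auto
          then show "openin ?T {x \<in> topspace ?T. snd x \<in> U}"
            using U by (simp only: openin_disjoint_union) (auto simp: openin_subtopology)
        qed
        show "open_map ?T X snd"
          unfolding open_map_def
        proof (intro allI impI)
          fix W assume W: "openin ?T W"
          then have "W \<subseteq> Sigma I S"
            using openin_subset top by blast
          then have "snd ` W = (\<Union>i\<in>I. {x. (i, x) \<in> W})"
            by force
          moreover have "openin X {x. (i, x) \<in> W}" if "i \<in> I" for i
            using W that opn openin_trans_full by (fastforce simp: openin_sum_topology)
          ultimately show "openin X (snd ` W)"
            by auto
        qed
        show "snd ` topspace ?T = topspace X"
          unfolding top using cov by force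
        show "inj_on snd (topspace ?T)"
          unfolding top using dis by (auto simp: inj_on_def disjoint_family_on_def)
      qed
    }
  qed
  then show ?thesis
    unfolding direct_sum_of_subspaces_def by blast
qed

lemma GCC_space_iff_not_direct_sum:
  "GCC_space X \<longleftrightarrow>
    \<not> (\<exists>\<S>. infinite \<S> \<and> (\<forall>S\<in>\<S>. S \<noteq> {}) \<and> direct_sum_of_subspaces X \<S> (\<lambda>S. S))"
proof -
  have "disjoint_family_on (\<lambda>S. S) \<S> \<longleftrightarrow> disjoint \<S>" for \<S> :: "'a set set"
    by (auto simp: disjoint_family_on_def disjoint_def)
  then show ?thesis
    unfolding GCC_space_def direct_sum_of_subspaces_iff_open by auto
qed

section \<open>Equivalence of the conditions\<close>

theorem theorem1:
  fixes X :: "'a topology"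
  shows
    "(GCC_space X \<longleftrightarrow>
        (\<forall>\<U>. (\<forall>U\<in>\<U>. openin X U) \<and> disjoint \<U> \<and> \<Union>\<U> = topspace X
             \<longrightarrow> has_finite_subcover X \<U>)) \<and>
     (GCC_space X \<longleftrightarrow>
        (\<forall>\<U>. countable \<U> \<and> (\<forall>U\<in>\<U>. clopenin X U) \<and> \<Union>\<U> = topspace X
             \<longrightarrow> has_finite_subcover X \<U>)) \<and>
     (GCC_space X \<longleftrightarrow>
        (\<forall>F :: nat \<Rightarrow> 'a set. decseq F \<and> (\<forall>n. clopenin X (F n) \<and> F n \<noteq> {})
             \<longrightarrow> (\<Inter>n. F n) \<noteq> {})) \<and>
     (GCC_space X \<longleftrightarrow>
        \<not> (\<exists>f. continuous_map X (discrete_topology (UNIV :: nat set)) f \<and>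
               f ` topspace X = UNIV)) \<and>
     (GCC_space X \<longleftrightarrow>
        \<not> (\<exists>\<S>. infinite \<S> \<and> (\<forall>S\<in>\<S>. S \<noteq> {}) \<and>
               direct_sum_of_subspaces X \<S> (\<lambda>S. S)))"
    (is "(_ \<longleftrightarrow> ?disjoint) \<and> (_ \<longleftrightarrow> ?clopen) \<and> (_ \<longleftrightarrow> ?decseq) \<and> (_ \<longleftrightarrow> ?nosurj) \<and> (_ \<longleftrightarrow> ?nosum)")
proof -
  have "?nosurj \<Longrightarrow> GCC_space X"
    using not_GCC_imp_surjection_onto_nat by blast
  moreover have "?decseq \<Longrightarrow> ?nosurj"
    using surjection_onto_nat_imp_clopen_decseq[of X] by meson
  moreover have "?clopen \<Longrightarrow> ?decseq"
    using clopen_decseq_imp_countable_clopen_cover[of _ X] by meson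
  moreover have "GCC_space X \<Longrightarrow> ?clopen"
    using countable_clopen_cover_imp_not_GCC[of _ X] by meson
  ultimately show ?thesis
    using GCC_space_iff_disjoint_open_covers[of X] GCC_space_iff_not_direct_sum[of X] by argo
qed

end
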